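(* Let $\lambda>0$, let $P,Q$ be points in $\Omega_\lambda=\{x\in\mathbb{R}^2:\ \|x\|<1/\lambda\}$, and let $r\ge1$ be a real number. Let $d_F$ be the distance induced by the $\lambda$-Funk metric $F$ on $\Omega_\lambda$. Then $$d_F(P,Q)=\frac1\lambda\ln r\quad\Longleftrightarrow\quad\left\|\frac{P}{r}-Q\right\|=\frac1\lambda\,\frac{r-1}{r}.$$
   Context: $\langle\cdot,\cdot\rangle$ and $\|\cdot\|$ denote the usual Euclidean inner product and norm on $\mathbb{R}^2$. For $\lambda>0$ the $\lambda$-Funk metric is the function $F:\Omega_\lambda\times\mathbb{R}^2\to\mathbb{R}$, $$F(x,y)=\frac{\sqrt{\lambda^2\langle x,y\rangle^2+\|y\|^2(1-\lambda^2\|x\|^2)}}{1-\lambda^2\|x\|^2}+\frac{\lambda\langle x,y\rangle}{1-\lambda^2\|x\|^2}.$$ For a piecewise regular curve $c:[\alpha,\beta]\to\Omega_\lambda$, its Finsler arc length is $\mathscr{L}_F(c)=\int_\alpha^\beta F(c(t),c'(t))\,dt$. The induced distance from $P$ to $Q$ is $d_F(P,Q)=\inf_c\mathscr{L}_F(c)$, the infimum being taken over all piecewise regular curves $c:[\alpha,\beta]\to\Omega_\lambda$ with $c(\alpha)=P$ and $c(\beta)=Q$; by convention $d_F(P,P)=0$. Note that $d_F$ need not be symmetric. *)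

theory Defs
  imports "HOL-Analysis.Analysis"
begin

definition funk_domain :: "real \<Rightarrow> (real ^ 2) set" where
  "funk_domain lam = {x. norm x < 1 / lam}"

definition funk_metric :: "real \<Rightarrow> real ^ 2 \<Rightarrow> real ^ 2 \<Rightarrow> real" where
  "funk_metric lam x y =
     sqrt (lam\<^sup>2 * (x \<bullet> y)\<^sup>2 + (norm y)\<^sup>2 * (1 - lam\<^sup>2 * (norm x)\<^sup>2)) / (1 - lam\<^sup>2 * (norm x)\<^sup>2)
     + lam * (x \<bullet> y) / (1 - lam\<^sup>2 * (norm x)\<^sup>2)"

text \<open>
  A regular curve is continuously differentiable with nowhere vanishing derivative, the
  derivatives at the endpoints being one-sided. (The library's \<open>C1_differentiable_on\<close> asks for
  two-sided derivatives, and \<open>piecewise_C1_differentiable_on\<close> lets the derivative be unbounded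
  near the exceptional points, so neither describes the pieces of a piecewise regular curve.)
\<close>

definition regular_curve :: "(real \<Rightarrow> real ^ 2) \<Rightarrow> real \<Rightarrow> real \<Rightarrow> bool" where
  "regular_curve c a b \<longleftrightarrow>
     (\<exists>D. continuous_on {a..b} D \<and>
          (\<forall>s\<in>{a..b}. (c has_vector_derivative D s) (at s within {a..b}) \<and> D s \<noteq> 0))"

definition piecewise_regular_curve :: "(real \<Rightarrow> real ^ 2) \<Rightarrow> real \<Rightarrow> real \<Rightarrow> bool" where
  "piecewise_regular_curve c a b \<longleftrightarrow>
     a < b \<and> continuous_on {a..b} c \<and>
     (\<exists>n t. t 0 = a \<and> t n = b \<and>
        (\<forall>i<n. t i < t (Suc i) \<and> regular_curve c (t i) (t (Suc i))))"

text \<open>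
  At the finitely many break points the derivative need not exist; the value of the integrand
  there is irrelevant.
\<close>

definition funk_length :: "real \<Rightarrow> (real \<Rightarrow> real ^ 2) \<Rightarrow> real \<Rightarrow> real \<Rightarrow> real" where
  "funk_length lam c a b =
     integral {a..b} (\<lambda>t. funk_metric lam (c t) (vector_derivative c (at t within {a..b})))"

definition funk_dist :: "real \<Rightarrow> real ^ 2 \<Rightarrow> real ^ 2 \<Rightarrow> real" where
  "funk_dist lam P Q =
     (if P = Q then 0
      else Inf {funk_length lam c a b | c a b.
                  piecewise_regular_curve c a b \<and> c ` {a..b} \<subseteq> funk_domain lam \<and>
                  c a = P \<and> c b = Q})"

end

theory Submission
  imports Defs
begin

text \<open>
  For \<open>y \<noteq> 0\<close> the number \<open>k = funk_metric lam x y\<close> is characterised geometrically: the ray from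
  \<open>x\<close> in direction \<open>y\<close> meets the circle of radius \<open>1 / lam\<close> in \<open>x + y / (lam * k)\<close>. Algebraically,
  \<open>k\<close> is the only number with \<open>norm ((lam * k) *\<^sub>R x + y) = k\<close>. Everything follows from this by
  comparing the metric with half-planes. A unit vector \<open>u\<close> determines the half-plane
  \<open>lam * (u \<bullet> x) < 1\<close>, which contains the disc and whose edge touches it in \<open>u / lam\<close>. The potential
  \<open>- ln (1 - lam * (u \<bullet> x)) / lam\<close> of this half-plane has a differential that the metric dominates
  (Cauchy-Schwarz), with equality in the directions that point from \<open>x\<close> to \<open>u / lam\<close>. Hence a curve
  is at least as long as the increase of any such potential, and a segment pointing to \<open>u / lam\<close> is
  exactly that long.

  If \<open>norm (P - r *\<^sub>R Q) = (r - 1) / lam\<close> with \<open>r > 1\<close>, then \<open>(r *\<^sub>R Q - P) /\<^sub>R (r - 1)\<close> is the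
  point where the ray from \<open>P\<close> through \<open>Q\<close> leaves the disc, and the potential belonging to it
  increases by \<open>ln r / lam\<close> from \<open>P\<close> to \<open>Q\<close>. So the segment is a shortest curve and the distance is
  \<open>ln r / lam\<close> (lemma \<open>funk_dist_eq_ln\<close>); for \<open>r = 1\<close> the equation says \<open>P = Q\<close>.
  Conversely, every pair \<open>P\<close>, \<open>Q\<close> has a solution \<open>r \<ge> 1\<close> of this equation by the
  intermediate value theorem, and the distance determines it because \<open>ln\<close> is injective.
\<close>

section \<open>The Funk metric and half-planes\<close>

lemma funk_domain_norm_less:
  assumes "lam > 0" and "x \<in> funk_domain lam"
  shows "lam * norm x < 1"
  using assms by (simp add: funk_domain_def field_simps)

lemma funk_domain_denominator_pos:
  assumes "lam > 0" and "x \<in> funk_domain lam"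
  shows "1 - lam\<^sup>2 * (norm x)\<^sup>2 > 0"
proof -
  have "(lam * norm x)\<^sup>2 < 1"
    using funk_domain_norm_less[OF assms] assms(1) by (simp add: abs_square_less_1)
  then show ?thesis by (simp add: power_mult_distrib)
qed

text \<open>The defining formula solves the quadratic equation that results from squaring this identity.\<close>

lemma funk_metric_norm_eq:
  assumes "lam > 0" and "x \<in> funk_domain lam"
  shows "norm ((lam * funk_metric lam x y) *\<^sub>R x + y) = funk_metric lam x y"
proof -
  define d where "d = 1 - lam\<^sup>2 * (norm x)\<^sup>2"
  define b where "b = lam * (x \<bullet> y)"
  define S where "S = sqrt (b\<^sup>2 + (norm y)\<^sup>2 * d)"
  define k where "k = funk_metric lam x y"
  have d: "d > 0" unfolding d_def by (rule funk_domain_denominator_pos[OF assms])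
  have "k = (S + b) / d"
    by (simp add: k_def funk_metric_def S_def b_def d_def power_mult_distrib add_divide_distrib)
  then have k: "d * k = S + b" using d by simp
  have S2: "S\<^sup>2 = b\<^sup>2 + (norm y)\<^sup>2 * d" using d by (simp add: S_def)
  have "\<bar>b\<bar> \<le> S"
    unfolding S_def using d by (intro real_le_rsqrt) simp
  then have "0 \<le> d * k" using k by linarith
  then have k0: "0 \<le> k" using d by (simp add: zero_le_mult_iff)
  have "(d * k - b)\<^sup>2 = b\<^sup>2 + (norm y)\<^sup>2 * d" using S2 k by simp
  then have "d * (d * k\<^sup>2 - 2 * b * k - (norm y)\<^sup>2) = 0"
    by (simp add: power2_eq_square algebra_simps)
  then have quad: "d * k\<^sup>2 - 2 * b * k - (norm y)\<^sup>2 = 0" using d by simp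
  have "(norm ((lam * k) *\<^sub>R x + y))\<^sup>2 = (lam * k)\<^sup>2 * (norm x)\<^sup>2 + 2 * k * b + (norm y)\<^sup>2"
    unfolding b_def power2_norm_eq_inner
    by (simp add: inner_add_left inner_add_right inner_commute power2_eq_square algebra_simps)
  also have "\<dots> = k\<^sup>2"
    using quad by (simp add: d_def power2_eq_square algebra_simps)
  finally show ?thesis using k0 unfolding k_def[symmetric]
    by (metis norm_ge_zero power2_eq_iff_nonneg)
qed

text \<open>The equation has no second solution, since its left-hand side is a contraction in \<open>k\<close>, with factor
  \<open>lam * norm x < 1\<close>.\<close>

lemma funk_metric_eqI:
  assumes "lam > 0" and "x \<in> funk_domain lam"
    and k: "norm ((lam * k) *\<^sub>R x + y) = k"
  shows "funk_metric lam x y = k"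
proof (rule ccontr)
  define l where "l = funk_metric lam x y"
  assume "funk_metric lam x y \<noteq> k"
  then have ne: "\<bar>l - k\<bar> > 0" by (simp add: l_def)
  have "\<bar>l - k\<bar> = \<bar>norm ((lam * l) *\<^sub>R x + y) - norm ((lam * k) *\<^sub>R x + y)\<bar>"
    using k funk_metric_norm_eq[OF assms(1,2), of y] by (simp add: l_def)
  also have "\<dots> \<le> norm (((lam * l) *\<^sub>R x + y) - ((lam * k) *\<^sub>R x + y))"
    by (rule norm_triangle_ineq3)
  also have "((lam * l) *\<^sub>R x + y) - ((lam * k) *\<^sub>R x + y) = (lam * (l - k)) *\<^sub>R x"
    by (simp add: algebra_simps)
  also have "norm \<dots> = \<bar>l - k\<bar> * (lam * norm x)" using assms(1) by (simp add: abs_mult)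
  also have "\<dots> < \<bar>l - k\<bar> * 1"
    using ne funk_domain_norm_less[OF assms(1,2)] by (intro mult_strict_left_mono) auto
  finally show False by simp
qed

lemma half_plane_pos:
  assumes "lam > 0" and "x \<in> funk_domain lam" and "norm u = 1"
  shows "1 - lam * (u \<bullet> x) > 0"
proof -
  have "u \<bullet> x \<le> norm x" using norm_cauchy_schwarz[of u x] assms(3) by simp
  then have "lam * (u \<bullet> x) \<le> lam * norm x" using assms(1) by simp
  then show ?thesis using funk_domain_norm_less[OF assms(1,2)] by linarith
qed

text \<open>
  For \<open>u \<bullet> y > 0\<close> the lower bound is the Funk metric of the half-plane \<open>lam * (u \<bullet> x) < 1\<close>. This
  half-plane contains the disc, so a ray leaves it no earlier than the disc, and its metric is no
  larger.
\<close>

lemma funk_metric_ge_half_plane: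
  assumes "lam > 0" and "x \<in> funk_domain lam" and "norm u = 1"
  shows "(u \<bullet> y) / (1 - lam * (u \<bullet> x)) \<le> funk_metric lam x y"
proof -
  define k where "k = funk_metric lam x y"
  have "u \<bullet> ((lam * k) *\<^sub>R x + y) \<le> norm u * norm ((lam * k) *\<^sub>R x + y)"
    by (rule norm_cauchy_schwarz)
  also have "\<dots> = k" using assms(3) funk_metric_norm_eq[OF assms(1,2), of y] by (simp add: k_def)
  finally have "u \<bullet> y \<le> k * (1 - lam * (u \<bullet> x))" by (simp add: inner_add_right algebra_simps)
  then show ?thesis using half_plane_pos[OF assms] by (simp add: k_def pos_divide_le_eq)
qed

lemma funk_metric_eq_half_plane:
  assumes "lam > 0" and "x \<in> funk_domain lam" and "norm u = 1"
    and "m > 0" and dir: "u - lam *\<^sub>R x = m *\<^sub>R y"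
  shows "funk_metric lam x y = (u \<bullet> y) / (1 - lam * (u \<bullet> x))"
proof -
  have y: "y = (1 / m) *\<^sub>R (u - lam *\<^sub>R x)" using dir \<open>m > 0\<close> by simp
  have uu: "u \<bullet> u = 1" using assms(3) by (simp add: norm_eq_1)
  have "(lam * (1 / m)) *\<^sub>R x + y = (1 / m) *\<^sub>R u" unfolding y by (simp add: algebra_simps)
  then have "funk_metric lam x y = 1 / m"
    using assms by (intro funk_metric_eqI) auto
  moreover have "u \<bullet> y = (1 / m) * (1 - lam * (u \<bullet> x))"
    unfolding y by (simp add: inner_diff_right uu)
  ultimately show ?thesis using half_plane_pos[OF assms(1-3)] by simp
qed

section \<open>Lengths of curves\<close>

text \<open>The half-plane metric is exact: integrated along a curve it gives a difference of potentials.\<close>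

lemma half_plane_has_integral:
  fixes c :: "real \<Rightarrow> real ^ 2"
  assumes "lam > 0" and "norm u = 1" and "a \<le> b"
    and dom: "c ` {a..b} \<subseteq> funk_domain lam"
    and der: "\<And>s. s \<in> {a..b} \<Longrightarrow> (c has_vector_derivative D s) (at s within {a..b})"
  shows "((\<lambda>s. (u \<bullet> D s) / (1 - lam * (u \<bullet> c s))) has_integral
      (ln (1 - lam * (u \<bullet> c a)) - ln (1 - lam * (u \<bullet> c b))) / lam) {a..b}"
proof -
  define h where "h s = - ln (1 - lam * (u \<bullet> c s)) / lam" for s
  have "((\<lambda>s. (u \<bullet> D s) / (1 - lam * (u \<bullet> c s))) has_integral (h b - h a)) {a..b}"
  proof (rule fundamental_theorem_of_calculus[OF assms(3)])
    fix s assume s: "s \<in> {a..b}"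
    have pos: "1 - lam * (u \<bullet> c s) > 0"
      using dom s by (intro half_plane_pos assms(1,2)) auto
    have "((\<lambda>s. u \<bullet> c s) has_vector_derivative u \<bullet> D s) (at s within {a..b})"
      by (rule bounded_linear.has_vector_derivative[OF bounded_linear_inner_right der[OF s]])
    then have uc: "((\<lambda>s. u \<bullet> c s) has_real_derivative u \<bullet> D s) (at s within {a..b})"
      by (simp add: has_real_derivative_iff_has_vector_derivative)
    have "(h has_real_derivative (u \<bullet> D s) / (1 - lam * (u \<bullet> c s))) (at s within {a..b})"
      unfolding h_def using pos assms(1)
      by (auto intro!: derivative_eq_intros uc simp: field_simps)
    then show "(h has_vector_derivative (u \<bullet> D s) / (1 - lam * (u \<bullet> c s))) (at s within {a..b})"
      by (simp add: has_real_derivative_iff_has_vector_derivative)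
  qed
  then show ?thesis by (simp add: h_def diff_divide_distrib)
qed

lemma continuous_on_funk_metric:
  fixes c D :: "real \<Rightarrow> real ^ 2"
  assumes "lam > 0" and "c ` S \<subseteq> funk_domain lam"
    and "continuous_on S c" and "continuous_on S D"
  shows "continuous_on S (\<lambda>s. funk_metric lam (c s) (D s))"
proof -
  have "1 - lam\<^sup>2 * (norm (c s))\<^sup>2 \<noteq> 0" if "s \<in> S" for s
    using funk_domain_denominator_pos[OF assms(1), of "c s"] assms(2) that by auto
  then show ?thesis
    unfolding funk_metric_def by (intro continuous_intros assms) auto
qed

text \<open>
  The integrand of \<open>funk_length\<close> is formed with the derivative relative to \<open>{a..b}\<close>. In the interior
  of a regular piece this is the derivative of the piece; the two endpoints form a null set.
\<close>

lemma regular_piece_integral: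
  assumes "lam > 0" and "norm u = 1" and "p < q" and sub: "{p..q} \<subseteq> {a..b}"
    and reg: "regular_curve c p q" and dom: "c ` {p..q} \<subseteq> funk_domain lam"
  obtains I where
    "((\<lambda>s. funk_metric lam (c s) (vector_derivative c (at s within {a..b}))) has_integral I) {p..q}"
    "(ln (1 - lam * (u \<bullet> c p)) - ln (1 - lam * (u \<bullet> c q))) / lam \<le> I"
proof -
  obtain D where D: "continuous_on {p..q} D"
    and der: "\<And>s. s \<in> {p..q} \<Longrightarrow> (c has_vector_derivative D s) (at s within {p..q})"
    using reg unfolding regular_curve_def by blast
  have "continuous_on {p..q} c"
    using der by (meson continuous_on_eq_continuous_within has_vector_derivative_continuous)
  then have "(\<lambda>s. funk_metric lam (c s) (D s)) integrable_on {p..q}"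
    by (intro integrable_continuous_real continuous_on_funk_metric assms D)
  then obtain I where I: "((\<lambda>s. funk_metric lam (c s) (D s)) has_integral I) {p..q}"
    by blast
  have "(ln (1 - lam * (u \<bullet> c p)) - ln (1 - lam * (u \<bullet> c q))) / lam \<le> I"
  proof (rule has_integral_le[OF half_plane_has_integral I])
    fix s assume "s \<in> {p..q}"
    then show "(u \<bullet> D s) / (1 - lam * (u \<bullet> c s)) \<le> funk_metric lam (c s) (D s)"
      using dom by (intro funk_metric_ge_half_plane assms(1,2)) auto
  qed (use assms der in auto)
  moreover have "((\<lambda>s. funk_metric lam (c s) (vector_derivative c (at s within {a..b})))
      has_integral I) {p..q}"
  proof (rule has_integral_spike_finite[OF _ _ I])
    show "finite {p, q}" by simp
  next
    fix s assume "s \<in> {p..q} - {p, q}"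
    then have s: "s \<in> {p<..<q}" by auto
    have "(c has_vector_derivative D s) (at s)"
      using der[of s] s by (metis at_within_Icc_at greaterThanLessThan_iff atLeastAtMost_iff less_imp_le)
    moreover have "s \<in> interior {a..b}"
      using s sub interior_mono[OF sub] by auto
    ultimately have "vector_derivative c (at s within {a..b}) = D s"
      by (metis at_within_interior vector_derivative_at)
    then show "funk_metric lam (c s) (vector_derivative c (at s within {a..b})) =
        funk_metric lam (c s) (D s)"
      by simp
  qed
  ultimately show ?thesis using that by blast
qed

text \<open>
  Integrability has to be carried through the induction over the pieces: \<open>integral\<close> is 0 on
  functions that are not integrable, so no lower bound would hold without it.
\<close>

lemma funk_length_ge:
  assumes "lam > 0" and "norm u = 1"
    and curve: "piecewise_regular_curve c a b" and dom: "c ` {a..b} \<subseteq> funk_domain lam"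
  shows "(ln (1 - lam * (u \<bullet> c a)) - ln (1 - lam * (u \<bullet> c b))) / lam \<le> funk_length lam c a b"
proof -
  let ?G = "\<lambda>s. funk_metric lam (c s) (vector_derivative c (at s within {a..b}))"
  let ?h = "\<lambda>s. ln (1 - lam * (u \<bullet> c s)) / lam"
  obtain n t where t: "t 0 = a" "t n = b"
    and step: "\<And>i. i < n \<Longrightarrow> t i < t (Suc i)"
    and reg: "\<And>i. i < n \<Longrightarrow> regular_curve c (t i) (t (Suc i))"
    using curve unfolding piecewise_regular_curve_def by blast
  have up: "t i \<le> t j" if "i \<le> j" "j \<le> n" for i j
    using that
  proof (induction j rule: dec_induct)
    case (step k)
    then show ?case using \<open>\<And>i. i < n \<Longrightarrow> t i < t (Suc i)\<close>[of k] by simp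
  qed simp
  have "\<exists>I. (?G has_integral I) {a..t i} \<and> ?h a - ?h (t i) \<le> I" if "i \<le> n" for i
    using that
  proof (induction i)
    case 0
    show ?case using t by (intro exI[of _ 0]) (simp add: has_integral_refl)
  next
    case (Suc i)
    then obtain I where I: "(?G has_integral I) {a..t i}" "?h a - ?h (t i) \<le> I" by auto
    have le: "a \<le> t i" "t i < t (Suc i)" "t (Suc i) \<le> b"
      using up[of 0 i] up[of "Suc i" n] step[of i] Suc.prems t by auto
    then have sub: "{t i..t (Suc i)} \<subseteq> {a..b}" by auto
    have "c ` {t i..t (Suc i)} \<subseteq> funk_domain lam" using sub dom by blast
    then obtain J where J: "(?G has_integral J) {t i..t (Suc i)}"
      "(ln (1 - lam * (u \<bullet> c (t i))) - ln (1 - lam * (u \<bullet> c (t (Suc i))))) / lam \<le> J"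
      using regular_piece_integral[OF assms(1,2) le(2) sub reg] Suc.prems by auto
    have "(?G has_integral (I + J)) {a..t (Suc i)}"
      by (rule has_integral_combine[OF _ _ I(1) J(1)]) (use le in auto)
    moreover have "?h a - ?h (t (Suc i)) \<le> I + J"
      using I(2) J(2) by (simp add: diff_divide_distrib)
    ultimately show ?case by blast
  qed
  from this[of n] obtain I where "(?G has_integral I) {a..b}" "?h a - ?h b \<le> I"
    using t by auto
  then show ?thesis
    unfolding funk_length_def by (simp add: integral_unique diff_divide_distrib)
qed

lemma regular_curve_segment:
  assumes "P \<noteq> Q"
  shows "regular_curve (\<lambda>s. P + s *\<^sub>R (Q - P)) a b"
proof -
  have "((\<lambda>s. P + s *\<^sub>R (Q - P)) has_vector_derivative Q - P) (at s within {a..b})" for s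
    by (auto intro!: derivative_eq_intros)
  then show ?thesis
    unfolding regular_curve_def using assms
    by (intro exI[of _ "\<lambda>_. Q - P"]) auto
qed

lemma piecewise_regular_curve_segment:
  assumes "P \<noteq> Q"
  shows "piecewise_regular_curve (\<lambda>s. P + s *\<^sub>R (Q - P)) 0 1"
proof -
  have "\<exists>n t. t 0 = 0 \<and> t n = 1 \<and>
      (\<forall>i<n. t i < t (Suc i) \<and> regular_curve (\<lambda>s. P + s *\<^sub>R (Q - P)) (t i) (t (Suc i)))"
    using regular_curve_segment[OF assms] by (intro exI[of _ "1::nat"] exI[of _ real]) auto
  then show ?thesis
    unfolding piecewise_regular_curve_def by (auto intro!: continuous_intros)
qed

lemma segment_in_funk_domain:
  assumes "P \<in> funk_domain lam" and "Q \<in> funk_domain lam"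
  shows "(\<lambda>s. P + s *\<^sub>R (Q - P)) ` {0..1} \<subseteq> funk_domain lam"
proof -
  have "funk_domain lam = ball 0 (1 / lam)" by (auto simp: funk_domain_def)
  then have "closed_segment P Q \<subseteq> funk_domain lam"
    using assms closed_segment_subset[OF _ _ convex_ball[of 0 "1 / lam"]] by simp
  moreover have "P + s *\<^sub>R (Q - P) \<in> closed_segment P Q" if "s \<in> {0..1}" for s
    unfolding closed_segment_def using that by (auto intro!: exI[of _ s] simp: algebra_simps)
  ultimately show ?thesis by blast
qed

section \<open>The distance\<close>

text \<open>
  The unit vector \<open>u\<close> below points to the place where the ray from \<open>P\<close> through \<open>Q\<close> leaves the disc;
  its potential is the one that is calibrated by the segment.
\<close>

lemma funk_dist_eq_ln:
  fixes P Q :: "real ^ 2"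
  assumes lam: "lam > 0" and P: "P \<in> funk_domain lam" and Q: "Q \<in> funk_domain lam"
    and "r \<ge> 1" and eq: "norm (P - r *\<^sub>R Q) = (r - 1) / lam"
  shows "funk_dist lam P Q = ln r / lam"
proof (cases "P = Q")
  case True
  have "P - r *\<^sub>R P = (1 - r) *\<^sub>R P" by (simp add: algebra_simps)
  then have "(r - 1) * norm P = (r - 1) * (1 / lam)"
    using eq True \<open>r \<ge> 1\<close> by simp
  moreover have "norm P \<noteq> 1 / lam" using P by (simp add: funk_domain_def)
  ultimately have "r = 1" by (metis mult_left_cancel eq_iff_diff_eq_0)
  then show ?thesis using True by (simp add: funk_dist_def)
next
  case False
  have "r \<noteq> 1" using eq False by auto
  then have r: "r > 1" using \<open>r \<ge> 1\<close> by simp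
  define u where "u = (lam / (r - 1)) *\<^sub>R (r *\<^sub>R Q - P)"
  have u1: "norm u = 1"
    using eq r lam by (simp add: u_def norm_minus_commute)
  have rQP: "r *\<^sub>R Q - P = ((r - 1) / lam) *\<^sub>R u"
    using r lam by (simp add: u_def)
  have "u \<bullet> (r *\<^sub>R Q - P) = (r - 1) / lam"
    unfolding rQP using u1 by (simp add: norm_eq_1)
  then have ratio: "1 - lam * (u \<bullet> P) = r * (1 - lam * (u \<bullet> Q))"
    using lam by (simp add: inner_diff_right field_simps)
  have potential: "(ln (1 - lam * (u \<bullet> P)) - ln (1 - lam * (u \<bullet> Q))) / lam = ln r / lam"
    using half_plane_pos[OF lam Q u1] r unfolding ratio by (simp add: ln_mult)
  let ?c = "\<lambda>s. P + s *\<^sub>R (Q - P)"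
  have c: "?c ` {0..1} \<subseteq> funk_domain lam" by (rule segment_in_funk_domain[OF P Q])
  have der: "(?c has_vector_derivative Q - P) (at s within {0..1})" for s
    by (auto intro!: derivative_eq_intros)
  have "((\<lambda>s. (u \<bullet> (Q - P)) / (1 - lam * (u \<bullet> ?c s))) has_integral
      (ln (1 - lam * (u \<bullet> ?c 0)) - ln (1 - lam * (u \<bullet> ?c 1))) / lam) {0..1}"
    by (rule half_plane_has_integral[OF lam u1 _ c der]) simp
  then have int: "((\<lambda>s. (u \<bullet> (Q - P)) / (1 - lam * (u \<bullet> ?c s))) has_integral ln r / lam) {0..1}"
    using potential by simp
  have "((\<lambda>s. funk_metric lam (?c s) (vector_derivative ?c (at s within {0..1})))
      has_integral ln r / lam) {0..1}"
  proof (rule has_integral_eq[OF _ int])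
    fix s :: real assume s: "s \<in> {0..1}"
    have "s * (r - 1) \<le> 1 * (r - 1)" using s r by (intro mult_right_mono) auto
    then have pos: "r - s * (r - 1) > 0" by simp
    \<comment> \<open>The direction \<open>Q - P\<close> is a positive multiple of \<open>u / lam - ?c s\<close>, so the half-plane bound
        is attained along the segment.\<close>
    define k where "k = lam / (r - 1)"
    have k: "k > 0" "lam = k * (r - 1)" using r lam by (simp_all add: k_def)
    have m: "k * (r - s * (r - 1)) > 0" using k(1) pos by simp
    have "u = k *\<^sub>R (r *\<^sub>R Q - P)" by (simp add: u_def k_def)
    then have "u - lam *\<^sub>R ?c s = (k * (r - s * (r - 1))) *\<^sub>R (Q - P)"
      unfolding k(2) by (simp add: algebra_simps)
    then have "funk_metric lam (?c s) (Q - P) = (u \<bullet> (Q - P)) / (1 - lam * (u \<bullet> ?c s))"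
      using c s by (intro funk_metric_eq_half_plane[OF lam _ u1 m]) (blast, assumption)
    moreover have "vector_derivative ?c (at s within {0..1}) = Q - P"
      using s by (intro vector_derivative_within_closed_interval[OF _ _ der]) auto
    ultimately show "(u \<bullet> (Q - P)) / (1 - lam * (u \<bullet> ?c s)) =
        funk_metric lam (?c s) (vector_derivative ?c (at s within {0..1}))"
      by simp
  qed
  then have len: "funk_length lam ?c 0 1 = ln r / lam"
    unfolding funk_length_def by (rule integral_unique)
  let ?L = "{funk_length lam c a b | c a b.
                  piecewise_regular_curve c a b \<and> c ` {a..b} \<subseteq> funk_domain lam \<and>
                  c a = P \<and> c b = Q}"
  have "Inf ?L = ln r / lam"
  proof (rule cInf_eq_minimum)
    show "ln r / lam \<in> ?L"
      using len c piecewise_regular_curve_segment[OF False]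
      by (intro CollectI exI[of _ ?c] exI[of _ "0::real"] exI[of _ "1::real"]) auto
  next
    fix l assume "l \<in> ?L"
    then show "ln r / lam \<le> l"
      using funk_length_ge[OF lam u1] potential by force
  qed
  then show ?thesis using False by (simp add: funk_dist_def)
qed

lemma funk_ratio_exists:
  fixes P Q :: "real ^ 2"
  assumes lam: "lam > 0" and Q: "Q \<in> funk_domain lam"
  shows "\<exists>r\<ge>1. norm (P - r *\<^sub>R Q) = (r - 1) / lam"
proof -
  define g where "g r = norm (P - r *\<^sub>R Q) - (r - 1) / lam" for r
  \<comment> \<open>The solution of \<open>norm P + R * norm Q = (R - 1) / lam\<close>, where the triangle inequality
      gives \<open>g R \<le> 0\<close>.\<close>
  define R where "R = (norm P + 1 / lam) / (1 / lam - norm Q)"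
  have d: "1 / lam - norm Q > 0" using Q by (simp add: funk_domain_def)
  have "1 / lam - norm Q \<le> norm P + 1 / lam" by (smt (verit) norm_ge_zero)
  then have R1: "1 \<le> R" unfolding R_def using d by (subst pos_le_divide_eq) auto
  have "R * (1 / lam - norm Q) = norm P + 1 / lam" using d by (simp add: R_def)
  then have R: "norm P + R * norm Q = (R - 1) / lam"
    by (simp add: algebra_simps diff_divide_distrib)
  have "g R \<le> 0"
    using norm_triangle_ineq4[of P "R *\<^sub>R Q"] R R1 by (simp add: g_def)
  moreover have "0 \<le> g 1" by (simp add: g_def)
  moreover have "continuous_on {1..R} g" unfolding g_def by (intro continuous_intros) (use lam in auto)
  ultimately obtain r where "1 \<le> r" "g r = 0" using IVT2'[of g R 0 1] R1 by blast
  then show ?thesis by (auto simp: g_def)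
qed

theorem theorem5:
  fixes lam r :: real and P Q :: "real ^ 2"
  assumes "lam > 0"
    and "P \<in> funk_domain lam" and "Q \<in> funk_domain lam"
    and "r \<ge> 1"
  shows "funk_dist lam P Q = (1 / lam) * ln r \<longleftrightarrow>
         norm ((1 / r) *\<^sub>R P - Q) = (1 / lam) * ((r - 1) / r)"
proof -
  have "P - r *\<^sub>R Q = r *\<^sub>R ((1 / r) *\<^sub>R P - Q)"
    using \<open>r \<ge> 1\<close> by (simp add: algebra_simps)
  then have "norm (P - r *\<^sub>R Q) = r * norm ((1 / r) *\<^sub>R P - Q)"
    using \<open>r \<ge> 1\<close> by (metis abs_of_nonneg norm_scaleR order_trans zero_le_one)
  then have scaled: "norm ((1 / r) *\<^sub>R P - Q) = (1 / lam) * ((r - 1) / r) \<longleftrightarrow>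
      norm (P - r *\<^sub>R Q) = (r - 1) / lam"
    using \<open>r \<ge> 1\<close> \<open>lam > 0\<close> by (auto simp: field_simps)
  show ?thesis
    unfolding scaled
  proof
    assume dist: "funk_dist lam P Q = (1 / lam) * ln r"
    obtain r' where r': "r' \<ge> 1" "norm (P - r' *\<^sub>R Q) = (r' - 1) / lam"
      using funk_ratio_exists[OF assms(1,3)] by blast
    then have "ln r' = ln r"
      using funk_dist_eq_ln[OF assms(1-3) r'] dist \<open>lam > 0\<close> by simp
    then have "r' = r" using r'(1) \<open>r \<ge> 1\<close> by simp
    then show "norm (P - r *\<^sub>R Q) = (r - 1) / lam" using r'(2) by simp
  next
    assume "norm (P - r *\<^sub>R Q) = (r - 1) / lam"
    then show "funk_dist lam P Q = (1 / lam) * ln r"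
      using funk_dist_eq_ln[OF assms] by simp
  qed
qed

end
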